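(* For every $l\in\{0,1,2,3,\ldots\}$, all positive integers $\alpha,\beta$ and every $x\in\mathbb{C}$, $$G_{l,q}^{(\alpha+\beta)}(x)=\sum_{n=0}^{l}\binom{l}{n}_{q}\,G_{n,q}^{(\alpha)}\,G_{l-n,q}^{(\beta)}(x).$$
   Context: Fix $q\in\mathbb{C}$ with $|q|<1$. Put $[x]_q=\frac{1-q^x}{1-q}$, $[n]_q!=[n]_q[n-1]_q\cdots[1]_q$ (with $[0]_q!=1$), and $\binom{k}{n}_q=\frac{[k]_q[k-1]_q\cdots[k-n+1]_q}{[n]_q!}$. The $q$-exponential is $e_q(z)=\sum_{l=0}^\infty \frac{z^l}{[l]_q!}$. For a positive integer $\alpha$, the $q$-Genocchi polynomials of order $\alpha$, $G_{n,q}^{(\alpha)}(x)$, are defined by the generating function (power series in $z$) $$\sum_{n=0}^{\infty}\frac{z^n}{[n]_q!}G_{n,q}^{(\alpha)}(x)=\left(\frac{[2]_q z}{e_q(z)+1}\right)^{\alpha}e_q(zx),$$ and the $q$-Genocchi numbers of order $\alpha$, $G_{n,q}^{(\alpha)}$, by $$\sum_{n=0}^{\infty}\frac{z^n}{[n]_q!}G_{n,q}^{(\alpha)}=\left(\frac{[2]_q z}{e_q(z)+1}\right)^{\alpha}.$$ *)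

theory Defs
  imports Complex_Main "HOL-Computational_Algebra.Formal_Power_Series"
begin

definition q_number :: "complex \<Rightarrow> nat \<Rightarrow> complex" where
  "q_number q n = (1 - q ^ n) / (1 - q)"

definition q_factorial :: "complex \<Rightarrow> nat \<Rightarrow> complex" where
  "q_factorial q n = (\<Prod>k=1..n. q_number q k)"

text \<open>For \<open>n > k\<close> the truncated subtraction is harmless: the factor at \<open>i = k\<close> is
  \<open>q_number q 0 = 0\<close>, so the product is 0.\<close>

definition q_binomial :: "complex \<Rightarrow> nat \<Rightarrow> nat \<Rightarrow> complex" where
  "q_binomial q k n = (\<Prod>i<n. q_number q (k - i)) / q_factorial q n"

definition q_exp :: "complex \<Rightarrow> complex fps" where
  "q_exp q = Abs_fps (\<lambda>l. 1 / q_factorial q l)"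

text \<open>All generating functions are formal power series in \<open>z = fps_X\<close>. The denominator
  \<open>q_exp q + 1\<close> has constant term 2, so the quotient is multiplication by its inverse
  in the ring of power series; \<open>e\<^sub>q(zx)\<close> is the substitution of \<open>x z\<close> for \<open>z\<close>.\<close>

definition q_genocchi_gf :: "complex \<Rightarrow> nat \<Rightarrow> complex fps" where
  "q_genocchi_gf q \<alpha> = ((fps_const (q_number q 2) * fps_X) / (q_exp q + 1)) ^ \<alpha>"

definition q_genocchi_poly_gf :: "complex \<Rightarrow> nat \<Rightarrow> complex \<Rightarrow> complex fps" where
  "q_genocchi_poly_gf q \<alpha> x =
     ((fps_const (q_number q 2) * fps_X) / (q_exp q + 1)) ^ \<alpha>
       * (q_exp q oo (fps_const x * fps_X))"

definition q_genocchi_number :: "complex \<Rightarrow> nat \<Rightarrow> nat \<Rightarrow> complex" where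
  "q_genocchi_number q \<alpha> n = q_factorial q n * fps_nth (q_genocchi_gf q \<alpha>) n"

definition q_genocchi_poly :: "complex \<Rightarrow> nat \<Rightarrow> nat \<Rightarrow> complex \<Rightarrow> complex" where
  "q_genocchi_poly q \<alpha> n x = q_factorial q n * fps_nth (q_genocchi_poly_gf q \<alpha> x) n"

lemma q_factorial_nonzero:
  assumes "norm q < 1"
  shows "q_factorial q n \<noteq> 0"
proof -
  have "q_number q k \<noteq> 0" if "k \<ge> 1" for k
  proof -
    have "norm (q ^ k) < 1"
      using assms that by (simp add: norm_power power_less_one_iff)
    then show ?thesis
      using assms by (auto simp: q_number_def)
  qed
  then show ?thesis
    by (auto simp: q_factorial_def)
qed

text \<open>The coefficients defined above are the unique ones satisfying the generating-function
  identities.\<close>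

lemma q_genocchi_number_iff:
  assumes "norm q < 1"
  shows "Abs_fps (\<lambda>n. g n / q_factorial q n) = q_genocchi_gf q \<alpha>
           \<longleftrightarrow> g = q_genocchi_number q \<alpha>"
  using q_factorial_nonzero[OF assms]
  by (auto simp: fps_eq_iff fun_eq_iff q_genocchi_number_def field_simps)

lemma q_genocchi_poly_iff:
  assumes "norm q < 1"
  shows "Abs_fps (\<lambda>n. g n / q_factorial q n) = q_genocchi_poly_gf q \<alpha> x
           \<longleftrightarrow> g = (\<lambda>n. q_genocchi_poly q \<alpha> n x)"
  using q_factorial_nonzero[OF assms]
  by (auto simp: fps_eq_iff fun_eq_iff q_genocchi_poly_def field_simps)

end

theory Submission imports Defs begin

text \<open>The generating function of the polynomials of order \<open>\<alpha> + \<beta>\<close> is the product of that of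
  the numbers of order \<open>\<alpha>\<close> and that of the polynomials of order \<open>\<beta>\<close>, since the exponent
  of \<open>[2]\<^sub>q z / (e\<^sub>q(z) + 1)\<close> is additive and the factor \<open>e\<^sub>q(zx)\<close> can be attached to
  the second power. The coefficient of \<open>z\<^sup>l\<close> in this product is a Cauchy convolution, and
  multiplying it by \<open>[l]\<^sub>q!\<close> turns it into the claimed sum because
  \<open>[l]\<^sub>q! = binom(l, n)\<^sub>q [n]\<^sub>q! [l - n]\<^sub>q!\<close>.\<close>

lemma falling_q_factorial_times_q_factorial:
  assumes "n \<le> l"
  shows "(\<Prod>i<n. q_number q (l - i)) * q_factorial q (l - n) = q_factorial q l"
  using assms
proof (induction n)
  case 0
  then show ?case by simp
next
  case (Suc n)
  then have "l - n = Suc (l - Suc n)"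
    by simp
  then have "q_factorial q (l - n) = q_factorial q (l - Suc n) * q_number q (l - n)"
    by (simp add: q_factorial_def)
  with Suc show ?case
    by (simp add: mult_ac)
qed

text \<open>For \<open>norm q < 1\<close> no \<open>[n]\<^sub>q!\<close> vanishes, so the denominator of the \<open>q\<close>-binomial
  coefficient cancels.\<close>

lemma q_binomial_times_q_factorials:
  assumes "norm q < 1" and "n \<le> l"
  shows "q_binomial q l n * q_factorial q n * q_factorial q (l - n) = q_factorial q l"
  using falling_q_factorial_times_q_factorial[OF assms(2), of q] q_factorial_nonzero[OF assms(1)]
  by (simp add: q_binomial_def)

lemma q_genocchi_poly_gf_add:
  "q_genocchi_poly_gf q (\<alpha> + \<beta>) x = q_genocchi_gf q \<alpha> * q_genocchi_poly_gf q \<beta> x"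
  by (simp add: q_genocchi_poly_gf_def q_genocchi_gf_def power_add mult.assoc)

theorem theorem2p4:
  fixes q x :: complex and l \<alpha> \<beta> :: nat
  assumes "norm q < 1" and "\<alpha> > 0" and "\<beta> > 0"
  shows "q_genocchi_poly q (\<alpha> + \<beta>) l x =
    (\<Sum>n=0..l. q_binomial q l n * q_genocchi_number q \<alpha> n * q_genocchi_poly q \<beta> (l - n) x)"
proof -
  have "q_genocchi_poly q (\<alpha> + \<beta>) l x =
      (\<Sum>n=0..l. q_factorial q l *
        (fps_nth (q_genocchi_gf q \<alpha>) n * fps_nth (q_genocchi_poly_gf q \<beta> x) (l - n)))"
    by (simp add: q_genocchi_poly_def q_genocchi_poly_gf_add fps_mult_nth sum_distrib_left)
  also have "\<dots> =
      (\<Sum>n=0..l. q_binomial q l n * q_genocchi_number q \<alpha> n * q_genocchi_poly q \<beta> (l - n) x)"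
  proof (rule sum.cong)
    fix n assume "n \<in> {0..l}"
    then have "q_factorial q l = q_binomial q l n * q_factorial q n * q_factorial q (l - n)"
      using q_binomial_times_q_factorials[OF assms(1)] by simp
    then show "q_factorial q l *
        (fps_nth (q_genocchi_gf q \<alpha>) n * fps_nth (q_genocchi_poly_gf q \<beta> x) (l - n)) =
        q_binomial q l n * q_genocchi_number q \<alpha> n * q_genocchi_poly q \<beta> (l - n) x"
      by (simp add: q_genocchi_number_def q_genocchi_poly_def mult_ac)
  qed simp
  finally show ?thesis .
qed

end
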